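(* Let $k=2^m r$ with $m>0$ an integer and $r$ an odd positive integer. Then for all integers $n\geq 1$, $$\overline{OPT}_k(n)\equiv 0 \pmod{2^{m+1}}.$$
   Context: An overpartition of a nonnegative integer $n$ is a non-increasing sequence of positive integers with sum $n$ in which the first occurrence of each number may be overlined. For an integer $k\geq 1$, an overpartition $k$-tuple of $n$ with odd parts is an (ordered) $k$-tuple $(\xi_1,\ldots,\xi_k)$ of overpartitions, all of whose parts are odd, such that the sum of all the parts of $\xi_1,\ldots,\xi_k$ is $n$. $\overline{OPT}_k(n)$ denotes the number of overpartition $k$-tuples of $n$ with odd parts. Its generating function is $$\sum_{n\geq 0}\overline{OPT}_k(n)q^n=\frac{f_2^{3k}}{f_1^{2k}f_4^k}=\prod_{i\geq 0}\left(\frac{1+q^{2i+1}}{1-q^{2i+1}}\right)^k,\qquad f_j:=\prod_{i\geq 1}(1-q^{ji}).$$ *)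

theory Defs
  imports Main "HOL-Number_Theory.Cong"
begin

text \<open>
  A sequence of parts, each of which may be overlined, is a list of pairs: the pair
  \<open>(a, b)\<close> is a part of size \<open>a\<close>, which is overlined iff \<open>b\<close> is \<open>True\<close>.
\<close>

definition weight :: "(nat \<times> bool) list \<Rightarrow> nat" where
  "weight xs = sum_list (map fst xs)"

definition is_overpartition :: "(nat \<times> bool) list \<Rightarrow> bool" where
  "is_overpartition xs \<longleftrightarrow>
     sorted_wrt (\<ge>) (map fst xs) \<and>
     (\<forall>x \<in> set xs. 0 < fst x) \<and>
     (\<forall>i < length xs. snd (xs ! i) \<longrightarrow> (\<forall>j < i. fst (xs ! j) \<noteq> fst (xs ! i)))"

definition odd_parts :: "(nat \<times> bool) list \<Rightarrow> bool" where
  "odd_parts xs \<longleftrightarrow> (\<forall>x \<in> set xs. odd (fst x))"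

definition odd_overpartition_tuples :: "nat \<Rightarrow> nat \<Rightarrow> (nat \<times> bool) list list set" where
  "odd_overpartition_tuples k n =
     {xss. length xss = k \<and>
           (\<forall>xs \<in> set xss. is_overpartition xs \<and> odd_parts xs) \<and>
           sum_list (map weight xss) = n}"

definition OPT :: "nat \<Rightarrow> nat \<Rightarrow> nat" where
  "OPT k n = card (odd_overpartition_tuples k n)"

text \<open>The set counted by \<^const>\<open>OPT\<close> is finite, so its cardinality is the true count.\<close>

lemma finite_overpartitions_le:
  "finite {xs. is_overpartition xs \<and> weight xs \<le> n}"
proof -
  have len: "length xs \<le> weight xs" if "\<forall>x \<in> set xs. 0 < fst x" for xs :: "(nat \<times> bool) list"
    using that by (induction xs) (auto simp: weight_def)
  have part: "fst x \<le> weight xs" if "x \<in> set xs" for x and xs :: "(nat \<times> bool) list"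
    using that unfolding weight_def by (intro member_le_sum_list) auto
  have "{xs. is_overpartition xs \<and> weight xs \<le> n} \<subseteq>
          {xs. set xs \<subseteq> {..n} \<times> UNIV \<and> length xs \<le> n}"
    using len part by (fastforce simp: is_overpartition_def intro: order_trans)
  moreover have "finite {xs. set xs \<subseteq> {..n} \<times> (UNIV :: bool set) \<and> length xs \<le> n}"
    by (intro finite_lists_length_le) auto
  ultimately show ?thesis by (rule finite_subset)
qed

lemma finite_odd_overpartition_tuples: "finite (odd_overpartition_tuples k n)"
proof -
  have "weight xs \<le> sum_list (map weight xss)" if "xs \<in> set xss" for xs xss
    using that by (intro member_le_sum_list) auto
  then have "odd_overpartition_tuples k n \<subseteq>
      {xss. set xss \<subseteq> {xs. is_overpartition xs \<and> weight xs \<le> n} \<and> length xss = k}"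
    by (auto simp: odd_overpartition_tuples_def)
  moreover have "finite {xss. set xss \<subseteq> {xs. is_overpartition xs \<and> weight xs \<le> n} \<and> length xss = k}"
    by (intro finite_lists_length_eq finite_overpartitions_le)
  ultimately show ?thesis by (rule finite_subset)
qed

end

theory Submission
  imports Defs "HOL-Computational_Algebra.Formal_Power_Series"
begin

text \<open>
  Let \<open>P\<close> be the generating function for a single overpartition with odd parts. Toggling the
  overline of the first part is a fixed-point-free involution on nonempty overpartitions, so
  \<open>P = 1 + 2 S\<close> with \<open>S\<close> integral. Since \<open>y\<^sup>2 - 1 = (y - 1) ((y - 1) + 2)\<close>,
  each squaring gains a factor 2, so \<open>P ^ (2 ^ m)\<close>, and with it \<open>P ^ k\<close>, is congruent
  to 1 modulo \<open>2 ^ (m + 1)\<close>.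
\<close>

definition odd_overpartitions :: "nat \<Rightarrow> (nat \<times> bool) list set" where
  "odd_overpartitions n = {xs. is_overpartition xs \<and> odd_parts xs \<and> weight xs = n}"

lemma finite_odd_overpartitions: "finite (odd_overpartitions n)"
  by (rule finite_subset[OF _ finite_overpartitions_le[of n]]) (auto simp: odd_overpartitions_def)

lemma odd_overpartitions_0: "odd_overpartitions 0 = {[]}"
proof -
  have "xs = []" if "is_overpartition xs" "weight xs = 0" for xs
    using that by (cases xs) (auto simp: is_overpartition_def weight_def)
  then show ?thesis
    by (auto simp: odd_overpartitions_def is_overpartition_def odd_parts_def weight_def)
qed

text \<open>The overline condition compares an entry only with strictly earlier ones, so it is
  vacuous at index 0. At later indices it sees the head only through its size \<open>a\<close>,
  never through its flag.\<close>

lemma is_overpartition_toggle_hd: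
  assumes "is_overpartition ((a, b) # xs)"
  shows "is_overpartition ((a, c) # xs)"
proof -
  have "fst (((a, c) # xs) ! j) = fst (((a, b) # xs) ! j)" for j
    by (cases j) auto
  \<comment> \<open>The premise \<open>j < i\<close> excludes index 0, the only place where the
    flags can differ.\<close>
  moreover have "snd (((a, c) # xs) ! i) = snd (((a, b) # xs) ! i)" if "j < i" for i j
    using that by (cases i) auto
  ultimately show ?thesis
    using assms unfolding is_overpartition_def by auto
qed

lemma odd_overpartitions_toggle_hd:
  "(a, b) # xs \<in> odd_overpartitions n \<longleftrightarrow> (a, c) # xs \<in> odd_overpartitions n"
  using is_overpartition_toggle_hd
  by (auto simp: odd_overpartitions_def odd_parts_def weight_def)

lemma even_card_odd_overpartitions:
  assumes "n > 0"
  shows "even (card (odd_overpartitions n))"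
proof -
  \<comment> \<open>\<open>B\<close> picks one representative from each orbit of the toggle, the one
    whose first part is not overlined. Restoring the flag of that part gives a bijection from
    \<open>B \<times> UNIV\<close>, and \<open>UNIV :: bool set\<close> has two elements.\<close>
  define B where "B = {(a, xs). (a, False) # xs \<in> odd_overpartitions n}"
  let ?f = "\<lambda>((a, xs), b). (a, b) # xs"
  have "odd_overpartitions n = ?f ` (B \<times> UNIV)"
  proof (intro equalityI subsetI)
    fix ys assume ys: "ys \<in> odd_overpartitions n"
    then have "ys \<noteq> []"
      using assms by (auto simp: odd_overpartitions_def weight_def)
    then obtain a b xs where "ys = (a, b) # xs"
      by (cases ys) auto
    moreover from this ys have "(a, xs) \<in> B"
      unfolding B_def using odd_overpartitions_toggle_hd by blast
    ultimately show "ys \<in> ?f ` (B \<times> UNIV)"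
      by force
  next
    fix ys assume "ys \<in> ?f ` (B \<times> UNIV)"
    then obtain a xs b where "ys = (a, b) # xs" "(a, False) # xs \<in> odd_overpartitions n"
      unfolding B_def by auto
    then show "ys \<in> odd_overpartitions n"
      using odd_overpartitions_toggle_hd by blast
  qed
  moreover have "inj_on ?f (B \<times> UNIV)"
    by (auto simp: inj_on_def)
  ultimately show ?thesis
    by (simp add: card_image card_cartesian_product)
qed

lemma odd_overpartition_tuples_Suc:
  "odd_overpartition_tuples (Suc k) n =
     (\<Union>i\<le>n. (\<lambda>(xs, xss). xs # xss) ` (odd_overpartitions i \<times> odd_overpartition_tuples k (n - i)))"
proof (intro equalityI subsetI)
  fix yss assume "yss \<in> odd_overpartition_tuples (Suc k) n"
  then obtain xs xss where "yss = xs # xss" "weight xs \<le> n" "xs \<in> odd_overpartitions (weight xs)"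
      "xss \<in> odd_overpartition_tuples k (n - weight xs)"
    by (cases yss) (auto simp: odd_overpartition_tuples_def odd_overpartitions_def)
  then show "yss \<in> (\<Union>i\<le>n. (\<lambda>(xs, xss). xs # xss) `
      (odd_overpartitions i \<times> odd_overpartition_tuples k (n - i)))"
    by force
qed (auto simp: odd_overpartition_tuples_def odd_overpartitions_def)

text \<open>Splitting a tuple by the weight \<open>i\<close> of its first component gives a Cauchy
  product, matching the coefficients of P * P ^ k.\<close>

lemma OPT_Suc: "OPT (Suc k) n = (\<Sum>i\<le>n. card (odd_overpartitions i) * OPT k (n - i))"
proof -
  let ?f = "\<lambda>(xs, xss). xs # xss"
  let ?S = "\<lambda>i. odd_overpartitions i \<times> odd_overpartition_tuples k (n - i)"
  have "OPT (Suc k) n = card (\<Union>i\<in>{..n}. ?f ` ?S i)"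
    by (simp add: OPT_def odd_overpartition_tuples_Suc)
  also have "\<dots> = (\<Sum>i\<in>{..n}. card (?f ` ?S i))"
  proof (rule card_UN_disjoint)
    show "\<forall>i\<in>{..n}. finite (?f ` ?S i)"
      by (simp add: finite_odd_overpartitions finite_odd_overpartition_tuples)
  \<comment> \<open>The pieces are disjoint because the weight of the head of a tuple determines
    \<open>i\<close>.\<close>
  qed (auto simp: odd_overpartitions_def)
  also have "\<dots> = (\<Sum>i\<le>n. card (?S i))"
    by (intro sum.cong refl card_image) (auto simp: inj_on_def)
  finally show ?thesis
    by (simp add: card_cartesian_product OPT_def)
qed

text \<open>The coefficients are integers rather than naturals so that 1 can be subtracted in a
  ring.\<close>

definition odd_overpartition_fps :: "int fps" where
  "odd_overpartition_fps = Abs_fps (\<lambda>n. int (card (odd_overpartitions n)))"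

lemma fps_nth_odd_overpartition_fps_power:
  "fps_nth (odd_overpartition_fps ^ k) n = int (OPT k n)"
proof (induction k arbitrary: n)
  case 0
  have "odd_overpartition_tuples 0 n = (if n = 0 then {[]} else {})"
    by (auto simp: odd_overpartition_tuples_def)
  then show ?case
    by (simp add: OPT_def)
next
  case (Suc k)
  then show ?case
    by (simp add: fps_mult_nth OPT_Suc odd_overpartition_fps_def atMost_atLeast0)
qed

text \<open>This passes between parity of individual counts and divisibility in the power series
  ring, where the squaring argument takes place.\<close>

lemma fps_const_dvd_iff:
  fixes F :: "'a::comm_ring_1 fps"
  shows "fps_const c dvd F \<longleftrightarrow> (\<forall>n. c dvd fps_nth F n)"
proof
  assume "\<forall>n. c dvd fps_nth F n"
  then obtain g where "\<And>n. fps_nth F n = c * g n"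
    unfolding dvd_def by metis
  then have "F = fps_const c * Abs_fps g"
    by (simp add: fps_eq_iff)
  then show "fps_const c dvd F" ..
qed (auto elim!: dvdE)

lemma two_power_dvd_power_minus_one:
  fixes x :: "'a::comm_ring_1"
  assumes "2 dvd x - 1"
  shows "2 ^ (m + 1) dvd x ^ (2 ^ m * r) - 1"
proof -
  have "2 ^ (m + 1) dvd x ^ (2 ^ m) - 1"
  proof (induction m)
    case 0
    then show ?case using assms by simp
  next
    case (Suc m)
    let ?y = "x ^ (2 ^ m)"
    \<comment> \<open>By the induction hypothesis \<open>?y - 1\<close> is divisible by
      \<open>2 ^ (m + 1)\<close>, hence by 2.\<close>
    have "2 dvd (?y - 1) + 2"
      using Suc by (intro dvd_add) (auto intro: dvd_trans[rotated])
    with Suc have "2 ^ (m + 1) * 2 dvd (?y - 1) * ((?y - 1) + 2)"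
      by (intro mult_dvd_mono)
    also have "(?y - 1) * ((?y - 1) + 2) = x ^ (2 ^ Suc m) - 1"
      by (simp add: algebra_simps flip: power_add mult_2)
    finally show ?case by (simp add: mult.commute)
  qed
  \<comment> \<open>With y = x ^ (2 ^ m), the quotient of y ^ r - 1 by y - 1 is a finite geometric
    sum.\<close>
  also have "x ^ (2 ^ m) - 1 dvd x ^ (2 ^ m * r) - 1"
    by (simp add: power_mult power_diff_1_eq)
  finally show ?thesis .
qed

theorem theorem2p6:
  fixes k m r n :: nat
  assumes "k = 2 ^ m * r" and "m > 0" and "odd r" and "r > 0" and "n \<ge> 1"
  shows "[OPT k n = 0] (mod 2 ^ (m + 1))"
proof -
  let ?P = odd_overpartition_fps
  \<comment> \<open>At \<open>i = 0\<close> the empty overpartition is cancelled by the subtracted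
    1; all other coefficients are even by the toggle.\<close>
  have "2 dvd fps_nth (?P - 1) i" for i
    using even_card_odd_overpartitions[of i]
    by (cases "i = 0") (simp_all add: odd_overpartition_fps_def odd_overpartitions_0)
  then have "2 dvd ?P - 1"
    by (simp add: numeral_fps_const fps_const_dvd_iff)
  then have "2 ^ (m + 1) dvd ?P ^ k - 1"
    unfolding assms(1) by (rule two_power_dvd_power_minus_one)
  then have "fps_const (2 ^ (m + 1)) dvd ?P ^ k - 1"
    by (simp only: numeral_fps_const fps_const_power)
  then have "2 ^ (m + 1) dvd fps_nth (?P ^ k - 1) n"
    unfolding fps_const_dvd_iff by blast
  \<comment> \<open>Since n \<ge> 1, the subtracted series 1 contributes nothing to the coefficient
    at \<open>n\<close>.\<close>
  then have "int (2 ^ (m + 1)) dvd int (OPT k n)"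
    using assms(5) by (simp add: fps_nth_odd_overpartition_fps_power)
  then show ?thesis
    unfolding int_dvd_int_iff by (simp add: cong_0_iff)
qed

end
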